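(* There is an absolute constant $C>0$ such that the following holds. Let $N$ be even, let $J\subseteq\{3,4,5,\dots\}$, and let nonnegative integers $n_j$, $j\in J$, satisfy $\sum_{j\in J} j\,n_j=N$. Let $\alpha$ be uniform on $\mathcal{C}_J$ and, independently, $\beta$ uniform on $\mathcal{C}_2$, and let $X_N$ be the number of orbits on $[N]$ of the subgroup of $S_N$ generated by $\alpha$ and $\beta$ (the number of connected components of the random surface). Then $$\mathrm{P}(X_N=1)\ge 1-CN^{-1}.$$
   Context: $\mathcal{C}_J$ is the conjugacy class of $S_N$ of permutations of $[N]$ with exactly $n_j$ cycles of length $j$ for each $j\in J$ and no other cycles; $\mathcal{C}_2$ is the class of fixed-point-free involutions of $[N]$. The random surface is obtained from $n=\sum_j n_j$ oriented polygons ($n_j$ with $j$ sides, all $N$ sides labeled by $[N]$, $\alpha$ sending each side to the next side of its polygon) by gluing sides in pairs according to $\beta$. *)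

theory Defs
  imports
    "HOL-Probability.Probability"
    "HOL-Combinatorics.Orbits"
    "HOL-Algebra.Sym_Groups"
    "HOL-Algebra.Group_Action"
begin

text \<open>The set of labels $[N]$ is \<open>{1..N}\<close>, the set permuted by the library's \<open>sym_group N\<close>.
  The cycles of a permutation are identified with the sets of their labels; a fixed point is a
  cycle of length 1 (\<open>Orbits.orbit p x\<close> is \<open>{x}\<close> if \<open>p x = x\<close>).\<close>

definition perm_cycles :: "nat \<Rightarrow> (nat \<Rightarrow> nat) \<Rightarrow> nat set set" where
  "perm_cycles N p = Orbits.orbit p ` {1..N}"

definition cycle_count :: "nat \<Rightarrow> (nat \<Rightarrow> nat) \<Rightarrow> nat \<Rightarrow> nat" where
  "cycle_count N p j = card {c \<in> perm_cycles N p. card c = j}"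

definition class_J :: "nat \<Rightarrow> nat set \<Rightarrow> (nat \<Rightarrow> nat) \<Rightarrow> (nat \<Rightarrow> nat) set" where
  "class_J N J n =
     {p \<in> carrier (sym_group N).
        (\<forall>j\<in>J. cycle_count N p j = n j) \<and> (\<forall>c\<in>perm_cycles N p. card c \<in> J)}"

definition class_2 :: "nat \<Rightarrow> (nat \<Rightarrow> nat) set" where
  "class_2 N =
     {p \<in> carrier (sym_group N). \<forall>x\<in>{1..N}. p x \<noteq> x \<and> p (p x) = x}"

definition num_components :: "nat \<Rightarrow> (nat \<Rightarrow> nat) \<Rightarrow> (nat \<Rightarrow> nat) \<Rightarrow> nat" where
  "num_components N \<alpha> \<beta> =
     card (orbits ((sym_group N)\<lparr>carrier := generate (sym_group N) {\<alpha>, \<beta>}\<rparr>)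
                  {1..N} (\<lambda>g. restrict g {1..N}))"

text \<open>The joint law of two independent uniform permutations. \<open>pmf_of_set\<close> is the
  uniform distribution only for finite non-empty sets; both classes are finite, and they are
  non-empty when \<open>N\<close> is even and \<open>(\<Sum>j\<in>J. j * n j) = N\<close>.\<close>

definition gluing_pmf ::
    "nat \<Rightarrow> nat set \<Rightarrow> (nat \<Rightarrow> nat) \<Rightarrow> ((nat \<Rightarrow> nat) \<times> (nat \<Rightarrow> nat)) pmf" where
  "gluing_pmf N J n = pair_pmf (pmf_of_set (class_J N J n)) (pmf_of_set (class_2 N))"

end

theory Submission
  imports Defs
begin

text \<open>If the group generated by \<open>\<alpha>\<close> and \<open>\<beta>\<close> is not transitive, then \<open>\<beta>\<close> preserves the union
  of some non-empty set \<open>U\<close> of cycles of \<open>\<alpha>\<close>, with \<open>\<bar>\<Union>U\<bar> \<le> N / 2\<close>. A fixed set of size \<open>s\<close> is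
  preserved with probability \<open>r(s) = f(s) f(N - s) / f(N)\<close> (\<open>preserve_ratio\<close>), where \<open>f(m)\<close> is the number of
  fixed-point-free involutions of an \<open>m\<close>-set; \<open>r\<close> vanishes at odd \<open>s\<close> and decreases along even
  \<open>s \<le> N / 2\<close>. All cycles have length at least 3, so a union bound over \<open>k = \<bar>U\<bar>\<close> gives
  at most \<open>\<Sum>k\<ge>1. (n choose k) r(h(k))\<close>, where \<open>n \<le> N / 3\<close> and \<open>h(k)\<close> (\<open>even_ceil3\<close>) is the
  least even number \<open>\<ge> 3 k\<close>. The terms \<open>k = 1, 2\<close> are \<open>O(1/N)\<close>, the terms \<open>k = 3, 4\<close> are \<open>O(1/N\<^sup>2)\<close>, and passing from
  \<open>k\<close> to \<open>k + 2\<close> does not increase a term, so all remaining terms together contribute \<open>O(1/N)\<close>.\<close>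

section \<open>Counting fixed-point-free involutions\<close>

definition fpf_involutions :: "'a set \<Rightarrow> ('a \<Rightarrow> 'a) set" where
  "fpf_involutions A = {p. p permutes A \<and> (\<forall>x\<in>A. p x \<noteq> x \<and> p (p x) = x)}"

text \<open>At even \<open>m\<close> this is the double factorial (m - 1)!!, and at odd
  \<open>m\<close> it is 0. The value 1 at 0 counts the identity on the empty set.\<close>

fun num_fpf :: "nat \<Rightarrow> nat" where
  "num_fpf 0 = 1"
| "num_fpf (Suc 0) = 0"
| "num_fpf (Suc (Suc m)) = Suc m * num_fpf m"

lemma finite_fpf_involutions: "finite A \<Longrightarrow> finite (fpf_involutions A)"
  unfolding fpf_involutions_def
  by (rule finite_subset[OF _ finite_permutations]) auto

text \<open>Classify by the partner \<open>b\<close> of \<open>a\<close>: composing with the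
  transposition of \<open>a\<close> and \<open>b\<close> undoes the 2-cycle and leaves a
  fixed-point-free involution of the remaining points.\<close>

lemma fpf_involutions_split:
  assumes "a \<in> A"
  shows "fpf_involutions A =
    (\<Union>b\<in>A - {a}. (\<circ>) (Transposition.transpose a b) ` fpf_involutions (A - {a, b}))"
proof (intro equalityI subsetI)
  fix p assume "p \<in> fpf_involutions A"
  then have p: "p permutes A" and inv: "\<And>x. x \<in> A \<Longrightarrow> p x \<noteq> x \<and> p (p x) = x"
    by (auto simp: fpf_involutions_def)
  define b where "b = p a"
  have b: "b \<in> A - {a}" "p b = a"
    using inv[OF assms] permutes_in_image[OF p] assms by (auto simp: b_def)
  define q where "q = Transposition.transpose a b \<circ> p"
  have other: "q x = p x" "p x \<in> A - {a, b}" if "x \<in> A - {a, b}" for x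
  proof -
    have "p x \<noteq> a" "p x \<noteq> b"
      using that inv[of x] b b_def by auto
    then show "q x = p x" "p x \<in> A - {a, b}"
      using that permutes_in_image[OF p] by (auto simp: q_def)
  qed
  have "q permutes A"
    unfolding q_def using assms b
    by (intro permutes_compose[OF p] permutes_swap_id) auto
  then have "q permutes (A - {a, b})"
    by (rule permutes_superset) (use b b_def in \<open>auto simp: q_def\<close>)
  then have "q \<in> fpf_involutions (A - {a, b})"
    using other inv by (auto simp: fpf_involutions_def)
  moreover have "p = Transposition.transpose a b \<circ> q"
    by (auto simp: q_def fun_eq_iff)
  ultimately show "p \<in> (\<Union>b\<in>A - {a}. (\<circ>) (Transposition.transpose a b) ` fpf_involutions (A - {a, b}))"
    using b by blast
next
  fix p assume "p \<in> (\<Union>b\<in>A - {a}. (\<circ>) (Transposition.transpose a b) ` fpf_involutions (A - {a, b}))"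
  then obtain b q where b: "b \<in> A - {a}" and q: "q \<in> fpf_involutions (A - {a, b})"
    and pq: "p = Transposition.transpose a b \<circ> q" by auto
  have q1: "q permutes A - {a, b}" and q2: "\<And>x. x \<in> A - {a, b} \<Longrightarrow> q x \<noteq> x \<and> q (q x) = x"
    using q by (auto simp: fpf_involutions_def)
  have fix_ab: "q a = a" "q b = b" using q1 by (auto intro: permutes_not_in)
  have "p permutes A" unfolding pq
    by (intro permutes_compose permutes_subset[OF q1] permutes_swap_id) (use b assms in auto)
  moreover have "p x \<noteq> x \<and> p (p x) = x" if "x \<in> A" for x
  proof (cases "x \<in> {a, b}")
    case True
    then show ?thesis using fix_ab b by (auto simp: pq)
  next
    case False
    then have "x \<in> A - {a, b}" using that by auto
    moreover from this have "q x \<in> A - {a, b}" using permutes_in_image[OF q1] by blast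
    ultimately show ?thesis using q2[of x] by (auto simp: pq)
  qed
  ultimately show "p \<in> fpf_involutions A" by (auto simp: fpf_involutions_def)
qed

lemma card_fpf_involutions:
  assumes "finite A"
  shows "card (fpf_involutions A) = num_fpf (card A)"
  using assms
proof (induction "card A" arbitrary: A rule: num_fpf.induct)
  case 1
  then have "fpf_involutions A = {id}" by (auto simp: fpf_involutions_def)
  with 1 show ?case by simp
next
  case 2
  then obtain a where "A = {a}" by (metis card_1_singletonE One_nat_def)
  then have "fpf_involutions A = {}"
    by (auto simp: fpf_involutions_def dest: permutes_in_image[of _ "{a}" a])
  with 2 show ?case by (metis card.empty num_fpf.simps(2))
next
  case (3 m)
  then obtain a where a: "a \<in> A" by fastforce
  let ?F = "\<lambda>b. (\<circ>) (Transposition.transpose a b) ` fpf_involutions (A - {a, b})"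
  \<comment> \<open>The partner of \<open>a\<close> can be read off from any member of the piece, so
    pieces for different \<open>b\<close> are disjoint.\<close>
  have val: "p a = b" if mem: "p \<in> ?F b" for p b
  proof -
    obtain q where "q permutes A - {a, b}" "p = Transposition.transpose a b \<circ> q"
      using mem unfolding fpf_involutions_def by blast
    then show ?thesis using permutes_not_in[of q "A - {a, b}" a] by simp
  qed
  have card_F: "card (?F b) = num_fpf m" if b: "b \<in> A - {a}" for b
  proof -
    have "inj ((\<circ>) (Transposition.transpose a b :: 'a \<Rightarrow> 'a))"
      by (rule injI) (metis comp_assoc id_comp transpose_comp_involutory)
    then have "card (?F b) = card (fpf_involutions (A - {a, b}))"
      by (meson card_image inj_on_subset subset_UNIV)
    also have "m = card (A - {a, b})"
      using 3(2) \<open>finite A\<close> a b by (subst card_Diff_subset) auto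
    then have "card (fpf_involutions (A - {a, b})) = num_fpf m"
      using 3(1)[of "A - {a, b}"] \<open>finite A\<close> by simp
    finally show ?thesis .
  qed
  have "card (fpf_involutions A) = (\<Sum>b\<in>A - {a}. card (?F b))"
    unfolding fpf_involutions_split[OF a]
  proof (rule card_UN_disjoint)
    show "\<forall>i\<in>A - {a}. \<forall>j\<in>A - {a}. i \<noteq> j \<longrightarrow> ?F i \<inter> ?F j = {}"
    proof (intro ballI impI)
      fix i j :: 'a assume "i \<noteq> j"
      then show "?F i \<inter> ?F j = {}" using val[of _ i] val[of _ j] by (metis disjoint_iff)
    qed
  qed (use \<open>finite A\<close> finite_fpf_involutions in auto)
  also have "\<dots> = (card A - 1) * num_fpf m"
    using card_F a by simp
  finally show ?case unfolding 3(2)[symmetric] by simp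
qed

text \<open>An involution mapping \<open>S\<close> into itself does the same with the complement, so
  it is the composition of its two restrictions, each extended by the identity. Hence composition of
  pairs covers all such involutions.\<close>

lemma card_fpf_involutions_preserving:
  assumes "finite A" "S \<subseteq> A"
  shows "card {p \<in> fpf_involutions A. p ` S \<subseteq> S} \<le> num_fpf (card S) * num_fpf (card A - card S)"
proof -
  have finS: "finite S" using assms finite_subset by auto
  let ?R = "\<lambda>p T x. if x \<in> T then p x else x"
  have part: "?R p T \<in> fpf_involutions T"
    if p: "p \<in> fpf_involutions A" and T: "p ` T \<subseteq> T" "T \<subseteq> A" for p T
  proof -
    have "finite T" using T assms finite_subset by auto
    moreover have "inj_on p T"
      using p permutes_inj inj_on_subset unfolding fpf_involutions_def by fastforce
    ultimately have "bij_betw p T T"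
      using T(1) by (simp add: bij_betw_def endo_inj_surj)
    then have "bij_betw (?R p T) T T" by (simp cong: bij_betw_cong)
    then have "?R p T permutes T" by (rule bij_imp_permutes) simp
    then show ?thesis using p T by (auto simp: fpf_involutions_def image_subset_iff)
  qed
  have "{p \<in> fpf_involutions A. p ` S \<subseteq> S} \<subseteq>
      (\<lambda>(q, r). q \<circ> r) ` (fpf_involutions S \<times> fpf_involutions (A - S))"
  proof
    fix p assume "p \<in> {p \<in> fpf_involutions A. p ` S \<subseteq> S}"
    then have p: "p \<in> fpf_involutions A" and pS: "p ` S \<subseteq> S" by auto
    have perm: "p permutes A" using p by (simp add: fpf_involutions_def)
    \<comment> \<open>If \<open>p x\<close> were in \<open>S\<close>, then so would be
      \<open>p (p x) = x\<close>.\<close>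
    have pC: "p ` (A - S) \<subseteq> A - S"
    proof
      fix y assume "y \<in> p ` (A - S)"
      then obtain x where x: "x \<in> A" "x \<notin> S" "y = p x" by auto
      have "p (p x) = x" using p x by (auto simp: fpf_involutions_def)
      then have "y \<notin> S" using pS x by (metis image_subset_iff)
      then show "y \<in> A - S" using x permutes_in_image[OF perm] by auto
    qed
    have "p = ?R p S \<circ> ?R p (A - S)"
    proof
      fix x
      show "p x = (?R p S \<circ> ?R p (A - S)) x"
        using pC assms permutes_not_in[OF perm, of x] by auto
    qed
    then show "p \<in> (\<lambda>(q, r). q \<circ> r) ` (fpf_involutions S \<times> fpf_involutions (A - S))"
      using part[OF p pS assms(2)] part[OF p pC] by (intro image_eqI[where x = "(?R p S, ?R p (A - S))"]) auto
  qed
  then have "card {p \<in> fpf_involutions A. p ` S \<subseteq> S} \<le>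
      card (fpf_involutions S \<times> fpf_involutions (A - S))"
    using assms(1) finS by (meson surj_card_le finite_SigmaI finite_fpf_involutions finite_Diff)
  also have "\<dots> = num_fpf (card S) * num_fpf (card A - card S)"
    using assms finS by (simp add: card_cartesian_product card_fpf_involutions card_Diff_subset)
  finally show ?thesis .
qed

lemma class_2_eq: "class_2 N = fpf_involutions {1..N}"
  by (auto simp: class_2_def fpf_involutions_def sym_group_carrier)

text \<open>The naturals are discrete, so a convergent sum has only finitely many non-zero terms.
  This turns the hypothesis on a possibly infinite \<open>J\<close> into a finite sum.\<close>

lemma has_sum_natD:
  fixes f :: "'a \<Rightarrow> nat"
  assumes "(f has_sum s) A"
  shows "finite {x \<in> A. f x \<noteq> 0}" "sum f {x \<in> A. f x \<noteq> 0} = s"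
proof -
  show fin: "finite {x \<in> A. f x \<noteq> 0}"
    using assms has_sum_imp_summable summable_on_discrete_iff by blast
  have "(f has_sum s) {x \<in> A. f x \<noteq> 0}"
    using assms by (subst has_sum_cong_neutral[where T = A and g = f]) auto
  then show "sum f {x \<in> A. f x \<noteq> 0} = s"
    using has_sum_finite[OF fin] has_sum_unique by blast
qed

section \<open>The probability that a fixed set is preserved\<close>

definition preserve_ratio :: "nat \<Rightarrow> nat \<Rightarrow> real" where
  "preserve_ratio N s = real (num_fpf s * num_fpf (N - s)) / real (num_fpf N)"

lemma num_fpf_pos: "even m \<Longrightarrow> num_fpf m > 0"
  by (induction m rule: num_fpf.induct) auto

lemma num_fpf_odd: "odd m \<Longrightarrow> num_fpf m = 0"
  by (induction m rule: num_fpf.induct) auto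

lemma preserve_ratio_nonneg: "preserve_ratio N s \<ge> 0"
  by (simp add: preserve_ratio_def)

lemma preserve_ratio_0: "even N \<Longrightarrow> preserve_ratio N 0 = 1"
  using num_fpf_pos[of N] by (simp add: preserve_ratio_def)

lemma preserve_ratio_odd: "odd s \<Longrightarrow> preserve_ratio N s = 0"
  by (simp add: preserve_ratio_def num_fpf_odd)

text \<open>Apply the recursion of \<open>num_fpf\<close> once at s + 2 and once at N - s.\<close>

lemma preserve_ratio_step:
  assumes "t = s + 2" "t \<le> N"
  shows "preserve_ratio N t * (real N - real s - 1) = preserve_ratio N s * (real s + 1)"
proof -
  obtain m where m: "N = s + 2 + m" using assms le_Suc_ex by blast
  then have "N - s = Suc (Suc m)" "N - t = m" using assms(1) by auto
  then have "num_fpf (N - s) = Suc m * num_fpf m" by (simp del: of_nat_Suc)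
  then show ?thesis
    unfolding preserve_ratio_def \<open>N - t = m\<close> by (simp add: assms(1) m algebra_simps)
qed

text \<open>Each step multiplies by (s + 1) / (N - s - 1), which is at most 1 below the
  middle.\<close>

lemma preserve_ratio_decreasing:
  assumes "2 * (s + 2 * d) \<le> N"
  shows "preserve_ratio N (s + 2 * d) \<le> preserve_ratio N s"
  using assms
proof (induction d)
  case (Suc d)
  let ?s = "s + 2 * d"
  have "preserve_ratio N (?s + 2) * (real N - real ?s - 1) = preserve_ratio N ?s * (real ?s + 1)"
    using Suc.prems by (intro preserve_ratio_step) auto
  also have "\<dots> \<le> preserve_ratio N ?s * (real N - real ?s - 1)"
    using Suc.prems by (intro mult_left_mono preserve_ratio_nonneg) auto
  finally have "preserve_ratio N (?s + 2) \<le> preserve_ratio N ?s"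
    using Suc.prems by (simp add: mult_le_cancel_right)
  then show ?case using Suc by simp
qed simp

text \<open>Below the middle N - s - 1 is at least N / 2, so each step gains a factor of order 1 /
  N.\<close>

lemma preserve_ratio_step_le:
  assumes "2 * (s + 2) \<le> N"
  shows "preserve_ratio N (s + 2) * real N \<le> preserve_ratio N s * (2 * (real s + 1))"
proof -
  have "preserve_ratio N (s + 2) * real N \<le> preserve_ratio N (s + 2) * (2 * (real N - real s - 1))"
    using assms by (intro mult_left_mono preserve_ratio_nonneg) auto
  also have "\<dots> = 2 * (preserve_ratio N (s + 2) * (real N - real s - 1))" by simp
  also have "\<dots> = preserve_ratio N s * (2 * (real s + 1))"
    using assms by (subst preserve_ratio_step) auto
  finally show ?thesis .
qed

text \<open>Two more cycles raise \<open>even_ceil3\<close> by 6, that is, by three steps of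
  2.\<close>

lemma preserve_ratio_step3:
  assumes "s + 6 \<le> N"
  shows "preserve_ratio N (s + 6) * ((real N - s - 1) * (real N - s - 3) * (real N - s - 5)) =
    preserve_ratio N s * ((real s + 1) * (real s + 3) * (real s + 5))"
proof -
  have "preserve_ratio N (s + 2) * (real N - real s - 1) = preserve_ratio N s * (real s + 1)"
    using preserve_ratio_step[of "s + 2" s N] assms by simp
  moreover have "preserve_ratio N (s + 4) * (real N - real s - 3) = preserve_ratio N (s + 2) * (real s + 3)"
    using preserve_ratio_step[of "s + 4" "s + 2" N] assms by (simp add: algebra_simps)
  moreover have "preserve_ratio N (s + 6) * (real N - real s - 5) = preserve_ratio N (s + 4) * (real s + 5)"
    using preserve_ratio_step[of "s + 6" "s + 4" N] assms by (simp add: algebra_simps)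
  ultimately show ?thesis by algebra
qed

section \<open>The terms of the union bound and their sum\<close>

definition even_ceil3 :: "nat \<Rightarrow> nat" where
  "even_ceil3 k = 3 * k + k mod 2"

lemma even_even_ceil3: "even (even_ceil3 k)"
  unfolding even_ceil3_def by presburger

lemma even_ceil3_add2: "even_ceil3 (k + 2) = even_ceil3 k + 6"
  by (simp add: even_ceil3_def)

definition union_term :: "nat \<Rightarrow> nat \<Rightarrow> nat \<Rightarrow> real" where
  "union_term N n k = real (n choose k) * preserve_ratio N (even_ceil3 k)"

lemma binomial_step2:
  "real (n choose (k + 2)) * ((real k + 1) * (real k + 2)) =
    real (n choose k) * ((real n - real k) * (real n - real k - 1))"
proof (cases "k + 2 \<le> n")
  case True
  have 1: "Suc j * (n choose Suc j) = (n - j) * (n choose j)" for j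
    by (metis binomial_absorb_comp binomial_absorption mult.commute)
  have "real (Suc k) * real (n choose Suc k) = real (n - k) * real (n choose k)"
    using 1[of k] by (metis of_nat_mult)
  moreover have "real (Suc (Suc k)) * real (n choose Suc (Suc k)) = real (n - Suc k) * real (n choose Suc k)"
    using 1[of "Suc k"] by (metis of_nat_mult)
  ultimately have "(1 + real k) * real (n choose Suc k) = (real n - real k) * real (n choose k)"
    "(2 + real k) * real (n choose Suc (Suc k)) = (real n - real k - 1) * real (n choose Suc k)"
    using True by (simp_all add: of_nat_diff)
  then show ?thesis by (simp add: numeral_2_eq_2) algebra
next
  \<comment> \<open>The left side vanishes, and on the right either the binomial coefficient or one
    of the two linear factors is 0.\<close>
  case False
  then consider "n < k" | "n = k" | "n = k + 1" by linarith
  then show ?thesis by cases (auto simp: binomial_eq_0)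
qed

text \<open>The inequality behind \<open>union_term_step\<close>, with A = N - 3 k, e = k mod 2 and
  s = 3 k + e. The lower bound on \<open>A\<close> is the condition 2 (s + 6) \<le> N.\<close>

lemma union_term_step_poly:
  fixes A k e :: real
  assumes "k \<ge> 0" "e = 0 \<or> e = 1" "A \<ge> 3 * k + 12 + 2 * e"
  shows "A * (A - 3) * ((3 * k + e + 1) * (3 * k + e + 3) * (3 * k + e + 5)) \<le>
    9 * ((k + 1) * (k + 2)) * ((A - e - 1) * (A - e - 3) * (A - e - 5))"
  using assms(2)
proof
  assume e: "e = 0"
  have "A * (3 * k + 1) \<le> A * (A - 6)"
    using assms e by (intro mult_left_mono) auto
  also have "\<dots> \<le> (A - 1) * (A - 5)" by (simp add: algebra_simps)
  finally have 1: "A * (3 * k + 1) \<le> (A - 1) * (A - 5)" .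
  have "A * (A - 3) * ((3 * k + 1) * (3 * k + 3) * (3 * k + 5)) =
      (A * (3 * k + 1)) * ((A - 3) * (3 * k + 3) * (3 * k + 5))" by (simp add: algebra_simps)
  \<comment> \<open>Raising 3 k + 5 to 3 k + 6 produces (3 k + 3) (3 k + 6) = 9 (k + 1) (k +
    2).\<close>
  also have "\<dots> \<le> ((A - 1) * (A - 5)) * ((A - 3) * (3 * k + 3) * (3 * k + 6))"
    using assms e by (intro mult_mono 1 mult_nonneg_nonneg) auto
  finally show ?thesis by (simp add: e algebra_simps)
next
  assume e: "e = 1"
  have "A * (A - 3) * (3 * k + 3) \<le> A * (A - 3) * (A - 11)"
    using assms e by (intro mult_left_mono) auto
  also have "\<dots> \<le> (A - 2) * (A - 4) * (A - 6)"
  proof -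
    \<comment> \<open>This expression is the difference of the two cubic products; it is visibly
      nonnegative because A is at least 14.\<close>
    have "0 \<le> (2 * A - 17) * (A + 14) + 190" using assms e by (intro add_nonneg_nonneg mult_nonneg_nonneg) auto
    then show ?thesis by (simp add: algebra_simps)
  qed
  finally have 1: "A * (A - 3) * (3 * k + 3) \<le> (A - 2) * (A - 4) * (A - 6)" .
  have 2: "(3 * k + 2) * (3 * k + 4) \<le> (3 * k + 3) * (3 * k + 3)" by (simp add: algebra_simps)
  have "A * (A - 3) * ((3 * k + 2) * (3 * k + 4) * (3 * k + 6)) =
      ((3 * k + 2) * (3 * k + 4)) * (A * (A - 3) * (3 * k + 6))" by (simp add: algebra_simps)
  also have "\<dots> \<le> ((3 * k + 3) * (3 * k + 3)) * (A * (A - 3) * (3 * k + 6))"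
    using assms e by (intro mult_right_mono 2 mult_nonneg_nonneg) auto
  also have "\<dots> = (A * (A - 3) * (3 * k + 3)) * ((3 * k + 3) * (3 * k + 6))" by (simp add: algebra_simps)
  also have "\<dots> \<le> ((A - 2) * (A - 4) * (A - 6)) * ((3 * k + 3) * (3 * k + 6))"
    using assms e by (intro mult_right_mono 1 mult_nonneg_nonneg) auto
  finally show ?thesis by (simp add: e algebra_simps)
qed

lemma union_term_step:
  assumes "3 * n \<le> N" "2 * even_ceil3 (k + 2) \<le> N"
  shows "union_term N n (k + 2) \<le> union_term N n k"
proof (cases "k + 2 \<le> n")
  case False
  then show ?thesis by (simp add: union_term_def preserve_ratio_nonneg binomial_eq_0)
next
  case True
  define s where "s = even_ceil3 k"
  define e where "e = real (k mod 2)"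
  define A where "A = real N - 3 * real k"
  \<comment> \<open>The binomial coefficient is multiplied by \<open>G / F\<close> and the ratio by
    \<open>E / D\<close>, so the claim reduces to \<open>G * E \<le> F * D\<close>.\<close>
  define D where "D = (real N - s - 1) * (real N - s - 3) * (real N - s - 5)"
  define E where "E = (real s + 1) * (real s + 3) * (real s + 5)"
  define F where "F = (real k + 1) * (real k + 2)"
  define G where "G = (real n - real k) * (real n - real k - 1)"
  have N: "2 * (s + 6) \<le> N" using assms(2) by (simp only: even_ceil3_add2 s_def)
  have s: "real s = 3 * real k + e" by (simp add: s_def e_def even_ceil3_def)
  have A: "A \<ge> 3 * real k + 12 + 2 * e"
    using of_nat_mono[OF N, where 'a = real] s by (simp add: A_def)
  have e: "e = 0 \<or> e = 1" unfolding e_def by auto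
  have DF: "D > 0" "F > 0"
    using N by (auto simp: D_def F_def)
  have "9 * G = (3 * real n - 3 * real k) * (3 * real n - 3 * real k - 3)"
    by (simp add: G_def algebra_simps)
  also have "\<dots> \<le> A * (A - 3)"
    using True assms(1) by (intro mult_mono) (auto simp: A_def)
  finally have "9 * G * E \<le> A * (A - 3) * E"
    by (intro mult_right_mono) (auto simp: E_def)
  also have "\<dots> \<le> 9 * F * D"
  proof -
    have eq: "real N - real s = A - e" by (simp add: s A_def)
    show ?thesis
      unfolding D_def E_def F_def eq unfolding s
      by (rule union_term_step_poly[OF of_nat_0_le_iff e A])
  qed
  finally have GE: "G * E \<le> F * D" by simp
  have "union_term N n (k + 2) * (F * D) =
      (real (n choose (k + 2)) * F) * (preserve_ratio N (s + 6) * D)"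
    by (simp add: union_term_def even_ceil3_add2 s_def del: add_2_eq_Suc')
  also have "\<dots> = (real (n choose k) * G) * (preserve_ratio N s * E)"
    unfolding F_def G_def D_def E_def
    using binomial_step2[of n k] preserve_ratio_step3[of s N] N by simp
  also have "\<dots> = union_term N n k * (G * E)" by (simp add: union_term_def s_def)
  also have "\<dots> \<le> union_term N n k * (F * D)"
    using GE by (intro mult_left_mono) (auto simp: union_term_def preserve_ratio_nonneg)
  finally show ?thesis using DF by simp
qed

text \<open>The ratio at h = \<open>even_ceil3 k\<close> has order N to the power -h/2 and the
  binomial coefficient at most order N to the power k; h/2 - k is 1 for k = 1, 2 and 2 for k = 3, 4.
  The constants round up 120 / 9 and 665280 / 81.\<close>

lemma union_term_small:
  assumes "N > 0" "even N" "3 * n \<le> N" "2 * even_ceil3 k \<le> N"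
  shows "k \<in> {1, 2} \<Longrightarrow> union_term N n k \<le> 14 / real N"
    and "k \<in> {3, 4} \<Longrightarrow> union_term N n k \<le> 8214 / real N ^ 2"
proof -
  have N: "real N > 0" using assms by simp
  have bin: "real (n choose k) \<le> (real N / 3) ^ k" 
  proof -
    have "n choose k \<le> n ^ k" by (cases "k \<le> n") (auto simp: binomial_le_pow binomial_eq_0)
    then have "real (n choose k) \<le> real n ^ k" by (metis of_nat_le_iff of_nat_power)
    also have "\<dots> \<le> (real N / 3) ^ k" using assms(3) by (intro power_mono) auto
    finally show ?thesis .
  qed
  \<comment> \<open>Starting from 1 at s = 0, every step multiplies the constant by 2 (s + 1). This
    yields 2, 12, 120, 1680, 30240, 665280 at s = 2, 4, 6, 8, 10, 12.\<close>
  have step: "preserve_ratio N (s + 2) * real N ^ Suc j \<le> 2 * (real s + 1) * c"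
    if "preserve_ratio N s * real N ^ j \<le> c" "2 * (s + 2) \<le> N" for s j c
  proof -
    have "preserve_ratio N (s + 2) * real N ^ Suc j = (preserve_ratio N (s + 2) * real N) * real N ^ j"
      by simp
    also have "\<dots> \<le> (preserve_ratio N s * (2 * (real s + 1))) * real N ^ j"
      by (intro mult_right_mono preserve_ratio_step_le that) simp
    also have "\<dots> = 2 * (real s + 1) * (preserve_ratio N s * real N ^ j)" by simp
    also have "\<dots> \<le> 2 * (real s + 1) * c" by (intro mult_left_mono that) simp
    finally show ?thesis .
  qed
  have 0: "preserve_ratio N 0 * real N ^ 0 \<le> 1" using assms preserve_ratio_0 by simp
  \<comment> \<open>Of the k + j powers of N, the bound (N / 3)^k on the binomial coefficient
    consumes k.\<close>
  have combine: "union_term N n k \<le> (c / 3 ^ k) / real N ^ j"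
    if "preserve_ratio N (even_ceil3 k) * real N ^ (k + j) \<le> c" for c j
  proof -
    have "union_term N n k * real N ^ (k + j) \<le>
        (real N / 3) ^ k * (preserve_ratio N (even_ceil3 k) * real N ^ (k + j))"
      unfolding union_term_def mult.assoc
      by (intro mult_right_mono bin) (simp add: preserve_ratio_nonneg)
    also have "\<dots> \<le> (real N / 3) ^ k * c" by (intro mult_left_mono that) simp
    finally have "union_term N n k * real N ^ j * real N ^ k \<le> (c / 3 ^ k) * real N ^ k"
      by (simp add: power_add power_divide mult_ac)
    then have "union_term N n k * real N ^ j \<le> c / 3 ^ k"
      by (rule mult_right_le_imp_le) (use N in simp)
    then show ?thesis using N by (simp add: pos_le_divide_eq mult_ac)
  qed
  have r4: "preserve_ratio N 4 * real N ^ 2 \<le> 12" if "8 \<le> N"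
    using step[OF step[OF 0]] that by (simp add: numeral_eq_Suc)
  have r6: "preserve_ratio N 6 * real N ^ 3 \<le> 120" if "12 \<le> N"
    using step[OF r4] that by (simp add: numeral_eq_Suc)
  have r10: "preserve_ratio N 10 * real N ^ 5 \<le> 30240" if "20 \<le> N"
    using step[OF step[OF r6]] that by (simp add: numeral_eq_Suc)
  have r12: "preserve_ratio N 12 * real N ^ 6 \<le> 665280" if "24 \<le> N"
    using step[OF r10] that by (simp add: numeral_eq_Suc)
  show "union_term N n k \<le> 14 / real N" if "k \<in> {1, 2}"
  proof -
    have "k = 1 \<or> k = 2" using that by simp
    then show ?thesis
    proof
      assume k: "k = 1"
      have "union_term N n k \<le> (12 / 3 ^ k) / real N ^ 1"
        using assms r4 by (intro combine) (simp add: k even_ceil3_def numeral_2_eq_2)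
      also have "\<dots> \<le> 14 / real N" using N by (simp add: k field_simps)
      finally show ?thesis .
    next
      assume k: "k = 2"
      have "union_term N n k \<le> (120 / 3 ^ k) / real N ^ 1"
        using assms r6 by (intro combine) (simp add: k even_ceil3_def)
      also have "\<dots> \<le> 14 / real N" using N by (simp add: k field_simps)
      finally show ?thesis .
    qed
  qed
  show "union_term N n k \<le> 8214 / real N ^ 2" if "k \<in> {3, 4}"
  proof -
    have "k = 3 \<or> k = 4" using that by simp
    then show ?thesis
    proof
      assume k: "k = 3"
      have "union_term N n k \<le> (30240 / 3 ^ k) / real N ^ 2"
        using assms r10 by (intro combine) (simp add: k even_ceil3_def)
      also have "\<dots> \<le> 8214 / real N ^ 2" using N by (simp add: k field_simps)
      finally show ?thesis .
    next
      assume k: "k = 4"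
      have "union_term N n k \<le> (665280 / 3 ^ k) / real N ^ 2"
        using assms r12 by (intro combine) (simp add: k even_ceil3_def)
      also have "\<dots> \<le> 8214 / real N ^ 2" using N by (simp add: k field_simps)
      finally show ?thesis .
    qed
  qed
qed

text \<open>Descending by 2 with \<open>union_term_step\<close> ends at 3 or 4, according to the
  parity of \<open>k\<close>.\<close>

lemma union_term_tail:
  assumes "N > 0" "even N" "3 * n \<le> N"
  shows "3 \<le> k \<Longrightarrow> 2 * even_ceil3 k \<le> N \<Longrightarrow> union_term N n k \<le> 8214 / real N ^ 2"
proof (induction k rule: less_induct)
  case (less k)
  show ?case
  proof (cases "k \<in> {3, 4}")
    case True
    then show ?thesis using union_term_small(2)[OF assms less.prems(2)] by simp
  next
    case False
    then obtain j where j: "k = j + 2" "3 \<le> j"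
      using less.prems(1) by (intro that[of "k - 2"]) auto
    have "union_term N n k \<le> union_term N n j"
      unfolding j using less.prems j by (intro union_term_step assms) auto
    also have "\<dots> \<le> 8214 / real N ^ 2"
      using less.prems(2) j even_ceil3_add2[of j] by (intro less.IH) auto
    finally show ?thesis .
  qed
qed

text \<open>Since 6 k \<le> 2 \<open>even_ceil3 k\<close> \<le> N, there are at most N / 6 indices.
  The tail is at most (N / 6) (8214 / N^2) = 1369 / N, and k = 1, 2 add at most 28 / N.\<close>

lemma sum_union_term_le:
  assumes "N > 0" "even N" "3 * n \<le> N"
  shows "(\<Sum>k | 1 \<le> k \<and> 2 * even_ceil3 k \<le> N. union_term N n k) \<le> 1400 / real N"
proof -
  let ?K = "{k. 1 \<le> k \<and> 2 * even_ceil3 k \<le> N}"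
  have sub: "?K \<subseteq> {1..N div 6}" by (auto simp: even_ceil3_def)
  then have fin: "finite ?K" by (rule finite_subset) simp
  have "sum (union_term N n) ?K = sum (union_term N n) (?K \<inter> {1, 2}) + sum (union_term N n) (?K - {1, 2})"
    by (rule sum.Int_Diff[OF fin])
  also have "sum (union_term N n) (?K \<inter> {1, 2}) \<le> (\<Sum>k\<in>?K \<inter> {1, 2}. 14 / real N)"
    using union_term_small(1)[OF assms] by (intro sum_mono) auto
  also have "\<dots> \<le> (\<Sum>k\<in>{1, 2 :: nat}. 14 / real N)"
    by (intro sum_mono2) auto
  also have "sum (union_term N n) (?K - {1, 2}) \<le> (\<Sum>k\<in>?K - {1, 2}. 8214 / real N ^ 2)"
    by (intro sum_mono union_term_tail assms) auto
  also have "\<dots> \<le> (\<Sum>k\<in>{1..N div 6}. 8214 / real N ^ 2)"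
    using sub by (intro sum_mono2) auto
  also have "\<dots> \<le> (real N / 6) * (8214 / real N ^ 2)"
    by (simp, intro divide_right_mono) (auto simp: real_of_nat_div)
  also have "\<dots> = 1369 / real N" using assms by (simp add: power2_eq_square field_simps)
  finally have "sum (union_term N n) ?K \<le> (\<Sum>k\<in>{1, 2 :: nat}. 14 / real N) + 1369 / real N" by simp
  also have "\<dots> = 1397 / real N" by (simp add: field_simps)
  also have "\<dots> \<le> 1400 / real N" by (intro divide_right_mono) auto
  finally show ?thesis .
qed

lemma sum_preserve_ratio_unions_le:
  assumes "N > 0" "even N" "partition_on A P" "finite A" "card A = N" "\<And>c. c \<in> P \<Longrightarrow> 3 \<le> card c"
  shows "(\<Sum>U | U \<subseteq> P \<and> U \<noteq> {} \<and> 2 * card (\<Union>U) \<le> N. preserve_ratio N (card (\<Union>U))) \<le> 1400 / real N"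
proof -
  have finP: "finite P" using finite_elements assms by blast
  have card_Un: "card (\<Union>U) = sum card U" if "U \<subseteq> P" for U
  proof (rule card_Union_disjoint)
    show "pairwise disjnt U"
      using pairwise_subset[OF partition_onD2[OF assms(3)] that] .
    show "finite c" if "c \<in> U" for c
      using that \<open>U \<subseteq> P\<close> partition_onD1[OF assms(3)] assms(4) by (metis Union_upper finite_subset subsetD)
  qed
  have ge: "3 * card U \<le> card (\<Union>U)" if "U \<subseteq> P" for U
    using sum_bounded_below[of U 3 card] subsetD[OF that, THEN assms(6)] card_Un[OF that]
    by (simp add: mult.commute)
  have n: "3 * card P \<le> N" using ge[of P] assms by (simp add: partition_on_def)
  let ?\<U> = "{U. U \<subseteq> P \<and> U \<noteq> {} \<and> 2 * card (\<Union>U) \<le> N}"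
  let ?K = "{k. 1 \<le> k \<and> 2 * even_ceil3 k \<le> N}"
  \<comment> \<open>The size condition on the union is relaxed to one on \<open>card U\<close>
    alone, so that for each admissible k all k-element subsets of \<open>P\<close> are
    counted.\<close>
  let ?\<V> = "{U. U \<subseteq> P \<and> card U \<in> ?K}"
  have fin: "finite ?\<V>" "finite ?\<U>" using finP by auto
  have finK: "finite ?K" by (rule finite_subset[of _ "{..N}"]) (auto simp: even_ceil3_def)
  \<comment> \<open>Unions of odd size contribute 0. For even size, |\<Union>U| \<ge> 3 |U| improves
    to |\<Union>U| \<ge> \<open>even_ceil3 (card U)\<close>, and monotonicity applies.\<close>
  let ?\<E> = "{U \<in> ?\<U>. even (card (\<Union>U))}"
  have le: "card U \<in> ?K \<and> preserve_ratio N (card (\<Union>U)) \<le> preserve_ratio N (even_ceil3 (card U))"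
    if "U \<in> ?\<E>" for U
  proof -
    have U: "U \<subseteq> P" "U \<noteq> {}" "2 * card (\<Union>U) \<le> N" "even (card (\<Union>U))" using that by auto
    have "even_ceil3 (card U) \<le> card (\<Union>U)"
      using ge[OF U(1)] U(4) even_even_ceil3[of "card U"] unfolding even_ceil3_def by presburger
    moreover from this have "even (card (\<Union>U) - even_ceil3 (card U))"
      using U(4) even_even_ceil3 by simp
    ultimately obtain d where d: "card (\<Union>U) = even_ceil3 (card U) + 2 * d"
      by (metis evenE le_add_diff_inverse)
    have "card U \<noteq> 0" using U finP finite_subset by (metis card_0_eq)
    then show ?thesis
      using d U(3) preserve_ratio_decreasing[of "even_ceil3 (card U)" d N] by auto
  qed
  have "(\<Sum>U\<in>?\<U>. preserve_ratio N (card (\<Union>U))) = (\<Sum>U\<in>?\<E>. preserve_ratio N (card (\<Union>U)))"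
    using fin(2) by (intro sum.mono_neutral_right) (auto intro: preserve_ratio_odd)
  also have "\<dots> \<le> (\<Sum>U\<in>?\<E>. preserve_ratio N (even_ceil3 (card U)))"
    using le by (intro sum_mono) auto
  also have "\<dots> \<le> (\<Sum>U\<in>?\<V>. preserve_ratio N (even_ceil3 (card U)))"
    using le fin by (intro sum_mono2) (auto intro: preserve_ratio_nonneg)
  also have "\<dots> = (\<Sum>k\<in>?K. \<Sum>U\<in>{U \<in> ?\<V>. card U = k}. preserve_ratio N (even_ceil3 (card U)))"
    using fin finK by (intro sum.group[symmetric]) auto
  also have "\<dots> = (\<Sum>k\<in>?K. union_term N (card P) k)"
  proof (intro sum.cong refl)
    fix k assume "k \<in> ?K"
    then have "{U \<in> ?\<V>. card U = k} = {U. U \<subseteq> P \<and> card U = k}" by auto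
    then show "(\<Sum>U\<in>{U \<in> ?\<V>. card U = k}. preserve_ratio N (even_ceil3 (card U))) = union_term N (card P) k"
      using n_subsets[OF finP, of k] by (simp add: union_term_def)
  qed
  also have "\<dots> \<le> 1400 / real N" by (intro sum_union_term_le assms n)
  finally show ?thesis .
qed

section \<open>Cycles as orbits, and permutations of prescribed cycle type\<close>

lemma permutes_self_in_orbit:
  assumes "finite A" "p permutes A"
  shows "x \<in> Orbits.orbit p x"
\<comment> \<open>\<open>Orbits.orbit p x\<close> is generated from \<open>p x\<close>, so that it
  returns to \<open>x\<close> rests on finiteness.\<close>
proof (rule permutation_self_in_orbit)
  show "permutation p" using assms by (auto simp: permutation_permutes)
qed

lemma partition_on_orbits:
  assumes "finite A" "p permutes A"
  shows "partition_on A (Orbits.orbit p ` A)"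
proof (rule partition_onI)
  note self = permutes_self_in_orbit[OF assms]
  show "\<Union>(Orbits.orbit p ` A) = A"
    using permutes_orbit_subset[OF assms(2)] self by blast
  show "{} \<notin> Orbits.orbit p ` A" using self by auto
  fix c d assume cd: "c \<in> Orbits.orbit p ` A" "d \<in> Orbits.orbit p ` A" "c \<noteq> d"
  have "Orbits.orbit p z = e" if "e \<in> Orbits.orbit p ` A" "z \<in> e" for e z
    using that orbit_cyclic_eq3[OF cyclic_on_orbit[OF assms(2,1)]] by auto
  then show "disjnt c d" using cd unfolding disjnt_iff by metis
qed

lemma exists_cyclic_on:
  assumes "finite B" "B \<noteq> {}"
  shows "\<exists>p. p permutes B \<and> cyclic_on p B"
  using assms
proof (induction B rule: finite_ne_induct)
  case (singleton x)
  have "Orbits.orbit id x = {x}" by (simp add: orbit_eq_singleton_iff)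
  then have "cyclic_on id {x}" by (simp add: cyclic_on_def)
  then show ?case using permutes_id by blast
next
  case (insert b B)
  then obtain p where p: "p permutes B" "cyclic_on p B" by blast
  obtain s where s: "s \<in> B" using insert by blast
  \<comment> \<open>This inserts \<open>b\<close> into the cycle just before \<open>s\<close>: the
    predecessor of \<open>s\<close> now goes to \<open>b\<close>, and \<open>b\<close> goes to
    \<open>s\<close>.\<close>
  define q where "q = Transposition.transpose b s \<circ> p"
  have q: "q permutes insert b B"
    unfolding q_def using s by (intro permutes_compose permutes_subset[OF p(1)] permutes_swap_id) auto
  have "p b = b" using p(1) insert by (auto intro: permutes_not_in)
  then have qb: "q b = s" by (simp add: q_def)
  have qs: "q z = b" if "p z = s" for z using that by (simp add: q_def)
  have qz: "q z = p z" if "z \<in> B" "p z \<noteq> s" for z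
    using that permutes_in_image[OF p(1), of z] insert by (auto simp: q_def intro!: transpose_apply_other)
  have orb: "B = Orbits.orbit p s" using p(2) s by (simp add: cyclic_on_alldef)
  \<comment> \<open>Either \<open>q z = p z\<close>, or \<open>p z = s\<close> and one further
    application of \<open>q\<close> leads from \<open>b\<close> to \<open>s\<close>.\<close>
  have step: "p z \<in> Orbits.orbit q s" if "z \<in> B" "q z \<in> Orbits.orbit q s" for z
    using that qb qs[of z] qz[of z] Orbits.orbit.step[of b q s] by (cases "p z = s") auto
  have "z \<in> Orbits.orbit q s" if "z \<in> Orbits.orbit p s" for z
    using that
  proof induction
    case base
    then show ?case using s by (intro step Orbits.orbit.base)
  next
    case (step y)
    then show ?case using orb \<open>\<And>z. _ \<Longrightarrow> _ \<Longrightarrow> p z \<in> _\<close> by (blast intro: Orbits.orbit.step)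
  qed
  then have sub: "B \<subseteq> Orbits.orbit q s" using orb by blast
  obtain y where "y \<in> B" "p y = s" using s permutes_image[OF p(1)] by (metis imageE)
  then have "b \<in> Orbits.orbit q s" using Orbits.orbit.step[of y q s] sub qs[of y] by auto
  with sub have "insert b B = Orbits.orbit q s"
    using permutes_orbit_subset[OF q, of s] s by blast
  then have "cyclic_on q (insert b B)" using s unfolding cyclic_on_def by blast
  then show ?case using q by blast
qed

text \<open>Cut off a subset of size \<open>m\<close>, permute it cyclically, and treat the rest by
  induction. As 0 is not in \<open>M\<close>, the subset is non-empty.\<close>

lemma exists_permutes_cycle_type:
  assumes "finite A" "sum_mset M = card A" "0 \<notin># M"
  shows "\<exists>p. p permutes A \<and> image_mset card (mset_set (Orbits.orbit p ` A)) = M"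
  using assms
proof (induction M arbitrary: A)
  case empty
  then show ?case by (intro exI[of _ id]) (auto intro: permutes_id)
next
  case (add m M)
  have "m \<le> card A" using add.prems(2) by simp
  then obtain B where B: "B \<subseteq> A" "card B = m"
    by (rule obtain_subset_with_card_n) blast
  have "finite B" "B \<noteq> {}" using B add.prems finite_subset by auto
  then obtain c where c: "c permutes B" "cyclic_on c B" using exists_cyclic_on by blast
  have "sum_mset M = card (A - B)"
    using add.prems B \<open>finite B\<close> by (simp add: card_Diff_subset)
  then obtain q where q: "q permutes A - B" "image_mset card (mset_set (Orbits.orbit q ` (A - B))) = M"
    using add.IH[of "A - B"] add.prems by auto
  let ?p = "c \<circ> q"
  have p: "?p permutes A"
    using B by (intro permutes_compose permutes_subset[OF q(1)] permutes_subset[OF c(1)]) auto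
  have "cyclic_on ?p B"
    by (rule permutes_comp_preserves_cyclic1[OF q(1) c(2), of B]) auto
  then have orb1: "Orbits.orbit ?p x = B" if "x \<in> B" for x
    using that by (rule orbit_cyclic_eq3)
  have orb2: "Orbits.orbit ?p x = Orbits.orbit q x" if "x \<in> A - B" for x
  proof (rule orbit_cong0)
    have q_in: "q y \<in> A - B" if "y \<in> A - B" for y using that permutes_in_image[OF q(1)] by blast
    then show eq: "?p y = q y" if "y \<in> A - B" for y
      using that permutes_not_in[OF c(1)] by simp
    show "?p \<in> A - B \<rightarrow> A - B" using q_in eq by (metis Pi_I)
  qed (fact that)
  have "Orbits.orbit ?p ` A = Orbits.orbit ?p ` B \<union> Orbits.orbit ?p ` (A - B)"
    using B by blast
  also have "\<dots> = insert B (Orbits.orbit q ` (A - B))"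
    using orb1 orb2 \<open>B \<noteq> {}\<close> by auto
  finally have "Orbits.orbit ?p ` A = insert B (Orbits.orbit q ` (A - B))" .
  moreover have "B \<notin> Orbits.orbit q ` (A - B)"
    using permutes_orbit_subset[OF q(1)] \<open>B \<noteq> {}\<close> by blast
  ultimately have "image_mset card (mset_set (Orbits.orbit ?p ` A)) = add_mset m M"
    using q(2) B add.prems(1) by simp
  then show ?case using p by blast
qed

text \<open>Needed because \<open>pmf_of_set\<close> is the uniform distribution only on non-empty
  finite sets.\<close>

lemma class_J_nonempty:
  assumes "((\<lambda>j. j * n j) has_sum N) J" "0 \<notin> J"
  shows "class_J N J n \<noteq> {}"
proof -
  let ?J = "{j \<in> J. j * n j \<noteq> 0}"
  \<comment> \<open>The multiset of cycle lengths. As 0 is not in \<open>J\<close>, a length in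
    \<open>J\<close> is left out of \<open>?J\<close> exactly when \<open>n j = 0\<close>.\<close>
  define M where "M = (\<Sum>j\<in>?J. replicate_mset (n j) j)"
  have fin: "finite ?J" and sum: "(\<Sum>j\<in>?J. j * n j) = N"
    using has_sum_natD[OF assms(1)] by auto
  have "sum_mset M = (\<Sum>j\<in>?J. j * n j)"
    unfolding M_def using fin by (induction rule: finite_induct) (auto simp: mult.commute)
  moreover have count: "count M i = (if i \<in> ?J then n i else 0)" for i
    unfolding M_def count_sum using fin by (simp add: if_distrib sum.delta cong: if_cong)
  moreover have set_M: "set_mset M \<subseteq> J"
    using count by (metis (mono_tags, lifting) count_eq_zero_iff mem_Collect_eq subsetI)
  ultimately obtain p where p: "p permutes {1..N}"
    and type: "image_mset card (mset_set (perm_cycles N p)) = M"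
    using exists_permutes_cycle_type[of "{1..N}" M] sum assms(2) unfolding perm_cycles_def by auto
  have finc: "finite (perm_cycles N p)" by (simp add: perm_cycles_def)
  have "cycle_count N p j = n j" if "j \<in> J" for j
  proof -
    have "count M j = cycle_count N p j"
      unfolding type[symmetric] cycle_count_def count_image_mset using finc
      by (simp add: vimage_def Int_def conj_commute)
    then show ?thesis using count[of j] that assms(2) by (auto split: if_splits)
  qed
  moreover have "card c \<in> J" if "c \<in> perm_cycles N p" for c
    using that set_M finc unfolding type[symmetric] by auto
  ultimately have "p \<in> class_J N J n"
    using p by (auto simp: class_J_def sym_group_carrier)
  then show ?thesis by blast
qed

section \<open>From non-transitivity to the union bound\<close>

lemma disconnected_imp_invariant_set:
  assumes "N > 0" "\<alpha> permutes {1..N}" "\<beta> permutes {1..N}" "num_components N \<alpha> \<beta> \<noteq> 1"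
  obtains S where "S \<subseteq> {1..N}" "S \<noteq> {}" "2 * card S \<le> N" "\<alpha> ` S \<subseteq> S" "\<beta> ` S \<subseteq> S"
proof -
  let ?H = "generate (sym_group N) {\<alpha>, \<beta>}"
  define Orb where "Orb x = (\<lambda>g. g x) ` ?H" for x
  have H: "?H \<subseteq> carrier (sym_group N)"
    using assms by (intro group.generate_incl[OF sym_group_is_group]) (auto simp: sym_group_carrier)
  have sub: "Orb x \<subseteq> {1..N}" if "x \<in> {1..N}" for x
    using H that permutes_in_image unfolding Orb_def sym_group_def by fastforce
  have "orbits ((sym_group N)\<lparr>carrier := ?H\<rparr>) {1..N} (\<lambda>g. restrict g {1..N}) = Orb ` {1..N}"
  proof -
    have "Group_Action.orbit ((sym_group N)\<lparr>carrier := ?H\<rparr>) (\<lambda>g. restrict g {1..N}) x = Orb x"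
      if "x \<in> {1..N}" for x
      using that unfolding Group_Action.orbit_def Orb_def by auto
    then show ?thesis unfolding orbits_def by blast
  qed
  then have "card (Orb ` {1..N}) \<noteq> 1" using assms(4) by (simp add: num_components_def)
  moreover have "Orb ` {1..N} = {{1..N}}" if "\<And>x. x \<in> {1..N} \<Longrightarrow> Orb x = {1..N}"
    using that assms(1) by (auto simp: image_constant_conv)
  ultimately obtain x where x: "x \<in> {1..N}" "Orb x \<noteq> {1..N}"
    by (metis card_1_singleton_iff One_nat_def)
  have closed: "h ` Orb x \<subseteq> Orb x" if "h \<in> {\<alpha>, \<beta>}" for h
  proof
    fix y assume "y \<in> h ` Orb x"
    then obtain g where g: "g \<in> ?H" "y = (h \<circ> g) x" by (auto simp: Orb_def)
    have "h \<circ> g \<in> ?H"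
      using generate.eng[OF generate.incl[OF that] g(1)] by (simp add: sym_group_mult)
    then show "y \<in> Orb x" unfolding Orb_def g(2) by (rule imageI)
  qed
  have ne: "Orb x \<noteq> {}"
    unfolding Orb_def using generate.one by blast
  \<comment> \<open>By finiteness and injectivity \<open>h\<close> maps the orbit onto itself, hence
    also preserves the complement. The smaller of the two sets serves as \<open>S\<close>.\<close>
  have compl: "h ` ({1..N} - Orb x) \<subseteq> {1..N} - Orb x" if h: "h \<in> {\<alpha>, \<beta>}" for h
  proof -
    have perm: "h permutes {1..N}" using h assms by auto
    have "h ` Orb x = Orb x"
      using closed[OF h] finite_subset[OF sub[OF x(1)]] inj_on_subset[OF permutes_inj[OF perm]]
      by (intro endo_inj_surj) auto
    then show ?thesis
      using permutes_image[OF perm] permutes_inj[OF perm] by (metis image_set_diff subset_refl)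
  qed
  show thesis
  proof (cases "2 * card (Orb x) \<le> N")
    case True
    then show thesis using that[of "Orb x"] sub[OF x(1)] ne closed by blast
  next
    case False
    have "card ({1..N} - Orb x) = N - card (Orb x)"
      using sub[OF x(1)] by (simp add: card_Diff_subset finite_subset)
    then show thesis
      using that[of "{1..N} - Orb x"] False sub[OF x(1)] x(2) compl by auto
  qed
qed

lemma card_disconnecting_le:
  assumes "N > 0" "even N" "\<alpha> permutes {1..N}" "\<And>c. c \<in> perm_cycles N \<alpha> \<Longrightarrow> 3 \<le> card c"
  shows "real (card {\<beta> \<in> class_2 N. num_components N \<alpha> \<beta> \<noteq> 1}) \<le> 1400 / real N * real (card (class_2 N))"
proof -
  let ?P = "perm_cycles N \<alpha>"
  let ?\<U> = "{U. U \<subseteq> ?P \<and> U \<noteq> {} \<and> 2 * card (\<Union>U) \<le> N}"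
  let ?F = "\<lambda>S. {\<beta> \<in> class_2 N. \<beta> ` S \<subseteq> S}"
  have part: "partition_on {1..N} ?P"
    unfolding perm_cycles_def using assms by (intro partition_on_orbits) auto
  have fin: "finite ?\<U>" by (simp add: perm_cycles_def)
  have fin2: "finite (class_2 N)" by (simp add: class_2_eq finite_fpf_involutions)
  have "{\<beta> \<in> class_2 N. num_components N \<alpha> \<beta> \<noteq> 1} \<subseteq> (\<Union>U\<in>?\<U>. ?F (\<Union>U))"
  proof
    fix \<beta> assume "\<beta> \<in> {\<beta> \<in> class_2 N. num_components N \<alpha> \<beta> \<noteq> 1}"
    then have \<beta>: "\<beta> \<in> class_2 N" "num_components N \<alpha> \<beta> \<noteq> 1" by auto
    then have "\<beta> permutes {1..N}" by (simp add: class_2_def sym_group_carrier)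
    then obtain S where S: "S \<subseteq> {1..N}" "S \<noteq> {}" "2 * card S \<le> N" "\<alpha> ` S \<subseteq> S" "\<beta> ` S \<subseteq> S"
      using disconnected_imp_invariant_set[OF assms(1,3) _ \<beta>(2)] by blast
    \<comment> \<open>An \<alpha>-invariant set is a union of cycles of \<alpha>; the witness
      \<open>U\<close> consists of the cycles through its points.\<close>
    have "y \<in> S" if "x \<in> S" "y \<in> Orbits.orbit \<alpha> x" for x y
      using that(2,1) S(4) by induction auto
    moreover have "x \<in> Orbits.orbit \<alpha> x" for x
      by (rule permutes_self_in_orbit[OF _ assms(3)]) simp
    ultimately have "\<Union>(Orbits.orbit \<alpha> ` S) = S" by blast
    then show "\<beta> \<in> (\<Union>U\<in>?\<U>. ?F (\<Union>U))"
      using S \<beta> by (intro UN_I[of "Orbits.orbit \<alpha> ` S"]) (auto simp: perm_cycles_def)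
  qed
  then have "card {\<beta> \<in> class_2 N. num_components N \<alpha> \<beta> \<noteq> 1} \<le> card (\<Union>U\<in>?\<U>. ?F (\<Union>U))"
    using fin fin2 by (intro card_mono) auto
  also have "\<dots> \<le> (\<Sum>U\<in>?\<U>. card (?F (\<Union>U)))" by (rule card_UN_le[OF fin])
  finally have "real (card {\<beta> \<in> class_2 N. num_components N \<alpha> \<beta> \<noteq> 1}) \<le> real (\<Sum>U\<in>?\<U>. card (?F (\<Union>U)))"
    by (rule of_nat_mono)
  also have "\<dots> = (\<Sum>U\<in>?\<U>. real (card (?F (\<Union>U))))" by (rule of_nat_sum)
  also have "\<dots> \<le> (\<Sum>U\<in>?\<U>. preserve_ratio N (card (\<Union>U)) * real (card (class_2 N)))"
  proof (rule sum_mono)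
    fix U assume "U \<in> ?\<U>"
    then have "\<Union>U \<subseteq> {1..N}" using partition_onD1[OF part] by blast
    then have "card (?F (\<Union>U)) \<le> num_fpf (card (\<Union>U)) * num_fpf (N - card (\<Union>U))"
      using card_fpf_involutions_preserving[of "{1..N}" "\<Union>U"] by (simp add: class_2_eq)
    \<comment> \<open>Evenness of \<open>N\<close> makes \<open>num_fpf N\<close> positive, so the
      denominator of the ratio cancels against \<open>card (class_2 N)\<close>.\<close>
    also have "real \<dots> = preserve_ratio N (card (\<Union>U)) * real (card (class_2 N))"
      using num_fpf_pos[OF assms(2)] by (simp add: preserve_ratio_def class_2_eq card_fpf_involutions)
    finally show "real (card (?F (\<Union>U))) \<le> preserve_ratio N (card (\<Union>U)) * real (card (class_2 N))"
      by simp
  qed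
  also have "\<dots> = (\<Sum>U\<in>?\<U>. preserve_ratio N (card (\<Union>U))) * real (card (class_2 N))"
    by (simp add: sum_distrib_right)
  also have "\<dots> \<le> 1400 / real N * real (card (class_2 N))"
    using sum_preserve_ratio_unions_le[OF assms(1,2) part _ _ assms(4)] by (intro mult_right_mono) auto
  finally show ?thesis .
qed

section \<open>From counting pairs to the probability\<close>

lemma pair_pmf_of_set:
  assumes "finite A" "A \<noteq> {}" "finite B" "B \<noteq> {}"
  shows "pair_pmf (pmf_of_set A) (pmf_of_set B) = pmf_of_set (A \<times> B)"
proof (rule pmf_eqI)
  fix z
  show "pmf (pair_pmf (pmf_of_set A) (pmf_of_set B)) z = pmf (pmf_of_set (A \<times> B)) z"
    using assms by (cases z) (simp add: pmf_pair indicator_def card_cartesian_product)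
qed

theorem theorem4p1:
  shows "\<exists>C::real. C > 0 \<and>
    (\<forall>(N::nat) (J::nat set) (n::nat \<Rightarrow> nat).
       N > 0 \<longrightarrow> even N \<longrightarrow> J \<subseteq> {3..} \<longrightarrow> ((\<lambda>j. j * n j) has_sum N) J \<longrightarrow>
       measure_pmf.prob (gluing_pmf N J n) {(\<alpha>, \<beta>). num_components N \<alpha> \<beta> = 1}
         \<ge> 1 - C / real N)"
proof (intro exI[of _ 1400] conjI allI impI)
  fix N :: nat and J :: "nat set" and n :: "nat \<Rightarrow> nat"
  assume N: "N > 0" "even N" and J: "J \<subseteq> {3..}" and sum: "((\<lambda>j. j * n j) has_sum N) J"
  let ?A = "class_J N J n" and ?B = "class_2 N"
  let ?good = "{(\<alpha>, \<beta>). num_components N \<alpha> \<beta> = 1}"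
  let ?bad = "\<lambda>\<alpha>. {\<beta> \<in> ?B. num_components N \<alpha> \<beta> \<noteq> 1}"
  have "?A \<subseteq> {p. p permutes {1..N}}" by (auto simp: class_J_def sym_group_carrier)
  then have A: "finite ?A" "?A \<noteq> {}"
    using class_J_nonempty[OF sum] J finite_subset[OF _ finite_permutations[of "{1..N}"]] by force+
  have cardB: "card ?B > 0"
    using num_fpf_pos[OF N(2)] by (simp add: class_2_eq card_fpf_involutions)
  then have B: "finite ?B" "?B \<noteq> {}" by (auto simp: card_gt_0_iff)
  have cardA: "card ?A > 0" using A by (simp add: card_gt_0_iff)
  have AB: "?A \<times> ?B \<noteq> {}" "finite (?A \<times> ?B)" using A B by auto
  \<comment> \<open>The bad pairs are counted fibrewise over \<alpha>, with the same bound in every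
    fibre.\<close>
  have "?A \<times> ?B - ?good = Sigma ?A ?bad" by auto
  then have "real (card (?A \<times> ?B - ?good)) = (\<Sum>\<alpha>\<in>?A. real (card (?bad \<alpha>)))"
    using A B by simp
  also have "\<dots> \<le> (\<Sum>\<alpha>\<in>?A. 1400 / real N * real (card ?B))"
  proof (intro sum_mono card_disconnecting_le N)
    fix \<alpha> assume \<alpha>: "\<alpha> \<in> ?A"
    then show "\<alpha> permutes {1..N}" by (simp add: class_J_def sym_group_carrier)
    show "3 \<le> card c" if "c \<in> perm_cycles N \<alpha>" for c
      using \<alpha> that J by (auto simp: class_J_def)
  qed
  also have "\<dots> = 1400 / real N * real (card (?A \<times> ?B))"
    by (simp add: card_cartesian_product)
  finally have "real (card (?A \<times> ?B - ?good)) \<le> 1400 / real N * real (card (?A \<times> ?B))" .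
  moreover have "card (?A \<times> ?B) = card (?A \<times> ?B \<inter> ?good) + card (?A \<times> ?B - ?good)"
    using card_Int_Diff AB(2) by blast
  ultimately have "(1 - 1400 / real N) * real (card (?A \<times> ?B)) \<le> real (card (?A \<times> ?B \<inter> ?good))"
    by (simp add: left_diff_distrib)
  moreover have "real (card (?A \<times> ?B)) > 0" using cardA cardB by (simp add: card_cartesian_product)
  ultimately have "1 - 1400 / real N \<le> real (card (?A \<times> ?B \<inter> ?good)) / real (card (?A \<times> ?B))"
    by (simp add: pos_le_divide_eq)
  then show "1 - 1400 / real N \<le> measure_pmf.prob (gluing_pmf N J n) ?good"
    unfolding gluing_pmf_def pair_pmf_of_set[OF A B] measure_pmf_of_set[OF AB] .
qed simp

end
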